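(* Let $\Bbbk$ be a field and let $X$ be a (finite, bounded) polyhedral complex of dimension $d$ with $\tilde H_d(X;\Bbbk)=0$. Let $B$ be a finite set which is the disjoint union of $B_1,\ldots,B_{d+1}$, and let $\{C_i\}_{i\in B}$ be a family of induced subcomplexes of $X$ such that for every $A\subseteq B$ the intersection $\bigcap_{i\in A}C_i$ is empty or acyclic over $\Bbbk$. Let $S=\Bbbk[x_i]_{i\in B}$ and let $I_\Delta\subseteq S$ be the square free monomial ideal generated by the monomials $\prod_{i\in B:\,v\notin C_i}x_i$, where $v$ ranges over the vertices of $X$. Suppose $I_\Delta$ is contained in each ideal $\langle x_i;\, i\in B_p\rangle$ generated by the variables of color $p$, for $p=1,\ldots,d+1$. Then there are $i_p\in B_p$ for each $p=1,\ldots,d+1$ such that $I_\Delta$ is contained in the ideal $\langle x_{i_1},\ldots,x_{i_{d+1}}\rangle$ generated by one variable of each color.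
   Context: A (bounded) polyhedral complex $X$ is a finite family of convex polytopes such that all faces of a polytope in $X$ are in $X$, and the intersection of any two polytopes in $X$ is a face of both. The subcomplex induced by a set $V'$ of vertices consists of all faces of $X$ whose vertices all lie in $V'$; an induced subcomplex is one of this form. The index sets $B_p$ are regarded as disjoint, but $C_i=C_j$ is allowed for $i\ne j$. The intersection over the empty index set is $X$. The variable $x_i$ is said to have color $p$ if $i\in B_p$. $\tilde H$ denotes reduced homology; acyclic over $\Bbbk$ means nonempty with vanishing reduced homology over $\Bbbk$. *)

theory Defs
  imports
    "HOL-Analysis.Analysis"
    "HOL-Library.Poly_Mapping"
    "HOL-Library.Disjoint_Sets"
    "HOL-Algebra.Ideal"
    "Jordan_Normal_Form.Determinant"
begin

section \<open>Polyhedral complexes\<close>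

text \<open>As in the library relation \<open>face_of\<close>, the empty polytope is a face of every polytope, so it
  is a cell of every complex; it has affine dimension \<open>-1\<close>. Complexes without a vertex thus contain
  just the empty cell, and ``empty'' below refers to the underlying space \<open>\<Union>X\<close>.\<close>

definition polyhedral_complex :: "'n::euclidean_space set set \<Rightarrow> bool" where
  "polyhedral_complex X \<longleftrightarrow>
     finite X \<and> {} \<in> X \<and>
     (\<forall>P\<in>X. polytope P) \<and>
     (\<forall>P\<in>X. \<forall>F. F face_of P \<longrightarrow> F \<in> X) \<and>
     (\<forall>P\<in>X. \<forall>Q\<in>X. (P \<inter> Q) face_of P \<and> (P \<inter> Q) face_of Q)"

definition complex_dim :: "'n::euclidean_space set set \<Rightarrow> int" where
  "complex_dim X = Max (aff_dim ` X)"

definition vertices :: "'n::euclidean_space set set \<Rightarrow> 'n set" where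
  "vertices X = {v. {v} \<in> X}"

definition induced_by :: "'n::euclidean_space set set \<Rightarrow> 'n set \<Rightarrow> 'n set set" where
  "induced_by X V' = {P \<in> X. \<forall>v. v extreme_point_of P \<longrightarrow> v \<in> V'}"

definition induced_subcomplex :: "'n::euclidean_space set set \<Rightarrow> 'n set set \<Rightarrow> bool" where
  "induced_subcomplex X Y \<longleftrightarrow> (\<exists>V'. V' \<subseteq> vertices X \<and> Y = induced_by X V')"

text \<open>Subcomplexes are families of cells; intersecting the families also intersects the underlying
  spaces, because any two cells of \<open>X\<close> meet in a common face. For \<open>A = {}\<close> this is \<open>X\<close>.\<close>

definition subcomplex_Inter ::
    "'n::euclidean_space set set \<Rightarrow> ('b \<Rightarrow> 'n set set) \<Rightarrow> 'b set \<Rightarrow> 'n set set" where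
  "subcomplex_Inter X C A = {P \<in> X. \<forall>i\<in>A. P \<in> C i}"

section \<open>Reduced homology with field coefficients\<close>

text \<open>The reduced homology of a polyhedral complex is that of its augmented cellular chain complex.
  A cell \<open>P\<close> is oriented by a chosen ordered basis of its direction space. A facet \<open>Q\<close> of \<open>P\<close> has
  incidence number \<open>1\<close> if an outward vector followed by the chosen basis of \<open>Q\<close> is positively
  oriented in \<open>P\<close>, and \<open>-1\<close> otherwise. The choices do not affect the homology up to isomorphism.\<close>

definition direction_space :: "'n::euclidean_space set \<Rightarrow> 'n set" where
  "direction_space P = span {x - y | x y. x \<in> P \<and> y \<in> P}"

definition orientation :: "'n::euclidean_space set \<Rightarrow> 'n list" where
  "orientation P = (SOME bs. distinct bs \<and> independent (set bs) \<and> span (set bs) = direction_space P)"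

text \<open>Modulo the direction space of the facet \<open>Q\<close>, all the vectors \<open>q - p\<close> below are positive
  multiples of each other.\<close>

definition outward_vector :: "'n::euclidean_space set \<Rightarrow> 'n set \<Rightarrow> 'n" where
  "outward_vector P Q = (SOME u. \<exists>q\<in>Q. \<exists>p\<in>P - Q. u = q - p)"

text \<open>For bases \<open>bs\<close>, \<open>cs\<close> of the same space with change of basis matrix \<open>M\<close> (that is,
  \<open>cs ! j = (\<Sum>i. M i j *\<^sub>R bs ! i)\<close>), the matrix of inner products is the Gram matrix of
  \<open>bs\<close> times \<open>M\<close>. As Gram determinants are positive, its determinant has the sign of \<open>det M\<close>.\<close>

definition same_orientation :: "'n::euclidean_space list \<Rightarrow> 'n list \<Rightarrow> bool" where
  "same_orientation bs cs \<longleftrightarrow>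
     0 < Determinant.det (Matrix.mat (length bs) (length cs) (\<lambda>(i, j). inner (bs ! i) (cs ! j)))"

text \<open>The only facet of a vertex is the empty cell (dimensions \<open>0\<close> and \<open>-1\<close>); its incidence number
  \<open>1\<close> makes the boundary map in degree \<open>0\<close> the augmentation.\<close>

definition incidence :: "'n::euclidean_space set \<Rightarrow> 'n set \<Rightarrow> int" where
  "incidence P Q =
     (if Q face_of P \<and> aff_dim Q = aff_dim P - 1
      then if Q = {} \<or> same_orientation (orientation P) (outward_vector P Q # orientation Q)
           then 1 else - 1
      else 0)"

definition cell_chains :: "'n::euclidean_space set set \<Rightarrow> int \<Rightarrow> ('n set \<Rightarrow> 'k::field) set" where
  "cell_chains Y p = {c. \<forall>P. c P \<noteq> 0 \<longrightarrow> P \<in> Y \<and> aff_dim P = p}"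

definition cell_boundary :: "'n::euclidean_space set set \<Rightarrow> ('n set \<Rightarrow> 'k::field) \<Rightarrow> ('n set \<Rightarrow> 'k)" where
  "cell_boundary Y c = (\<lambda>Q. \<Sum>P\<in>Y. of_int (incidence P Q) * c P)"

definition reduced_cycles :: "'n::euclidean_space set set \<Rightarrow> int \<Rightarrow> ('n set \<Rightarrow> 'k::field) set" where
  "reduced_cycles Y p = {c \<in> cell_chains Y p. cell_boundary Y c = (\<lambda>_. 0)}"

definition reduced_boundaries :: "'n::euclidean_space set set \<Rightarrow> int \<Rightarrow> ('n set \<Rightarrow> 'k::field) set" where
  "reduced_boundaries Y p = cell_boundary Y ` cell_chains Y (p + 1)"

text \<open>The field of coefficients is passed as a type.\<close>

definition reduced_homology_zero :: "'k::field itself \<Rightarrow> 'n::euclidean_space set set \<Rightarrow> int \<Rightarrow> bool" where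
  "reduced_homology_zero K Y p \<longleftrightarrow>
     (reduced_cycles Y p :: ('n set \<Rightarrow> 'k) set) = reduced_boundaries Y p"

definition acyclic_over :: "'k::field itself \<Rightarrow> 'n::euclidean_space set set \<Rightarrow> bool" where
  "acyclic_over K Y \<longleftrightarrow> \<Union>Y \<noteq> {} \<and> (\<forall>p. reduced_homology_zero K Y p)"

section \<open>The polynomial ring and the monomial ideal\<close>

text \<open>A polynomial maps exponent vectors to coefficients, both with finite support. The product of
  the type \<open>poly_mapping\<close> is convolution.\<close>

type_synonym ('b, 'k) mpoly = "('b \<Rightarrow>\<^sub>0 nat) \<Rightarrow>\<^sub>0 'k"

definition poly_ring :: "'b set \<Rightarrow> ('b, 'k::field) mpoly ring" where
  "poly_ring B =
     \<lparr>carrier = {f. \<forall>m\<in>Poly_Mapping.keys f. Poly_Mapping.keys m \<subseteq> B},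
      monoid.mult = (*), one = 1, zero = 0, add = (+)\<rparr>"

definition var :: "'b \<Rightarrow> ('b, 'k::field) mpoly" where
  "var i = Poly_Mapping.single (Poly_Mapping.single i 1) 1"

definition var_ideal :: "'b set \<Rightarrow> 'b set \<Rightarrow> ('b, 'k::field) mpoly set" where
  "var_ideal B F = genideal (poly_ring B) (var ` F)"

definition I_Delta ::
    "'n::euclidean_space set set \<Rightarrow> 'b set \<Rightarrow> ('b \<Rightarrow> 'n set set) \<Rightarrow> ('b, 'k::field) mpoly set" where
  "I_Delta X B C =
     genideal (poly_ring B) ((\<lambda>v. \<Prod>i\<in>{i\<in>B. v \<notin> vertices (C i)}. var i) ` vertices X)"

end

theory Submission
  imports Defs
begin

text \<open>A monomial lies in an ideal generated by variables iff it involves one of them. Hence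
  \<open>I_Delta X B C\<close> is contained in the ideal of the variables in \<open>F\<close> iff no vertex of \<open>X\<close> lies in all
  \<open>C i\<close> with \<open>i \<in> F\<close>, that is, iff these subcomplexes have no nonempty cell in common
  (\<open>I_Delta_subset_var_ideal_iff\<close> and \<open>no_common_vertex_iff\<close>). The theorem thus becomes a colourful Helly
  theorem: if the subcomplexes of each of the \<open>d + 1\<close> colours have empty intersection, then so have the
  subcomplexes of some transversal.

  Suppose that every transversal has a nonempty intersection. Then the intersections over partial
  transversals are nonempty, hence acyclic, too. The proof derives a contradiction from the Lefschetz
  fixed point theorem, in the form \<open>alternating_trace_eq_0\<close>: a chain map from the acyclic complex \<open>X\<close> to itself has alternating trace \<open>0\<close>, the empty cell included. A chain map
  that fixes the empty cell, and in which no other cell occurs in its own image, has alternating trace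
  \<open>1\<close>, which is not \<open>0\<close> in any field. So it suffices to construct one.

  Choose for every nonempty cell \<open>P\<close> an index \<open>\<iota> P\<close> with \<open>P \<notin> C (\<iota> P)\<close>, whose colour is
  the dimension of \<open>P\<close> plus one; the dimension is at most \<open>d\<close>, so there are enough colours. Along a flag of
  cells the colours are distinct, so \<open>\<iota>\<close> maps the barycentric subdivision of \<open>X\<close> simplicially to the
  complex of partial transversals. From there, a chain map \<open>g\<close> leads back to \<open>X\<close>: the union of the
  subcomplexes of a partial transversal is acyclic by Mayer--Vietoris (\<open>exact_on_UN\<close>), so \<open>g\<close> can be chosen
  by acyclic carriers (\<open>nerve_map_exists\<close>), with the image of a partial transversal in that union. The
  composition (\<open>flag_map\<close>) sends \<open>P\<close> to a chain on subcomplexes \<open>C (\<iota> Q)\<close> for faces \<open>Q\<close> of \<open>P\<close>. Such a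
  subcomplex does not contain \<open>Q\<close>, and therefore not \<open>P\<close>.\<close>

section \<open>Alternating sums over the faces of a list\<close>

text \<open>The simplicial boundary in dual form: a simplex is the list of its vertices, and \<open>F\<close> assigns values
  to simplices. The face without the vertex \<open>v\<close> carries the sign \<open>(-1) ^ k\<close>, where \<open>k\<close> counts the
  vertices after \<open>v\<close>; so a vertex put in front does not change the signs of the other faces.\<close>

fun face_sum :: "('b list \<Rightarrow> 'k::comm_ring_1) \<Rightarrow> 'b list \<Rightarrow> 'k" where
  "face_sum F [] = 0"
| "face_sum F (v # L) = (-1) ^ length L * F L + face_sum (\<lambda>L'. F (v # L')) L"

lemma face_sum_cong:
  "(\<And>L'. length L = Suc (length L') \<Longrightarrow> set L' \<subseteq> set L \<Longrightarrow> F L' = G L') \<Longrightarrow> face_sum F L = face_sum G L"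
proof (induction L arbitrary: F G)
  case (Cons v L)
  have "F L = G L" by (rule Cons.prems) auto
  moreover have "face_sum (\<lambda>L'. F (v # L')) L = face_sum (\<lambda>L'. G (v # L')) L"
    by (rule Cons.IH) (rule Cons.prems, auto)
  ultimately show ?case by simp
qed simp

lemma face_sum_zero: "face_sum (\<lambda>L'. 0) L = 0"
  by (induction L) auto

lemma face_sum_add: "face_sum (\<lambda>L'. F L' + G L') L = face_sum F L + face_sum G L"
  by (induction L arbitrary: F G) (auto simp: algebra_simps)

lemma face_sum_mult: "face_sum (\<lambda>L'. a * F L') L = a * face_sum F L"
  by (induction L arbitrary: F) (auto simp: algebra_simps)

lemma face_sum_sum:
  "face_sum (\<lambda>L'. \<Sum>x\<in>S. a x * F x L') L = (\<Sum>x\<in>S. a x * face_sum (F x) L)"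
  by (induction S rule: infinite_finite_induct)
    (auto simp: face_sum_zero face_sum_add face_sum_mult)

lemma face_sum_eq_0I:
  "(\<And>L'. length L = Suc (length L') \<Longrightarrow> set L' \<subseteq> set L \<Longrightarrow> F L' = 0) \<Longrightarrow> face_sum F L = 0"
  using face_sum_cong[of L F "\<lambda>_. 0"] by (simp add: face_sum_zero)

text \<open>Two vertices can be deleted in either order, and the two resulting terms have opposite signs.\<close>

lemma face_sum_face_sum: "face_sum (face_sum F) L = 0"
proof (induction L arbitrary: F)
  case (Cons v L)
  \<comment> \<open>All faces of \<open>L\<close> have the same length, one less than that of \<open>L\<close>.\<close>
  have sign: "face_sum (\<lambda>L'. (-1) ^ length L' * F L') L = - ((-1) ^ length L * face_sum F L)"
    (is "?l = _")
  proof -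
    have "?l = face_sum (\<lambda>L'. - ((-1) ^ length L) * F L') L"
      by (rule face_sum_cong) simp
    then show ?thesis unfolding face_sum_mult by simp
  qed
  show ?case by (simp add: face_sum_add Cons.IH sign)
qed simp

section \<open>Chain complexes with a finite basis of cells\<close>

text \<open>The cells form a basis of a chain complex of free modules, and \<open>inc\<close> is the matrix of its boundary
  map. The cells of rank \<open>0\<close> play the role of the empty simplex, so these are augmented complexes, and
  \<open>rank\<close> is the dimension plus one.\<close>

locale based_complex =
  fixes X :: "'c set" and rank :: "'c \<Rightarrow> nat" and inc :: "'c \<Rightarrow> 'c \<Rightarrow> 'k::comm_ring_1"
  assumes finite_cells: "finite X"
    and inc_cell: "P \<in> X \<Longrightarrow> inc P Q \<noteq> 0 \<Longrightarrow> Q \<in> X"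
    and inc_rank: "P \<in> X \<Longrightarrow> inc P Q \<noteq> 0 \<Longrightarrow> rank P = Suc (rank Q)"
    and inc_inc: "P \<in> X \<Longrightarrow> (\<Sum>Q\<in>X. inc P Q * inc Q R) = 0"
begin

definition bd :: "('c \<Rightarrow> 'k) \<Rightarrow> 'c \<Rightarrow> 'k" where
  "bd c = (\<lambda>Q. \<Sum>P\<in>X. inc P Q * c P)"

definition chains :: "'c set \<Rightarrow> nat \<Rightarrow> ('c \<Rightarrow> 'k) set" where
  "chains Y n = {c. \<forall>P. c P \<noteq> 0 \<longrightarrow> P \<in> Y \<and> rank P = n}"

definition closed_cells :: "'c set \<Rightarrow> bool" where
  "closed_cells Y \<longleftrightarrow> Y \<subseteq> X \<and> (\<forall>P\<in>Y. \<forall>Q. inc P Q \<noteq> 0 \<longrightarrow> Q \<in> Y)"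

text \<open>For a set \<open>Y\<close> of cells that is closed under the boundary this says that the subcomplex \<open>Y\<close> has no
  homology in any degree; if one of its cells plays the role of the empty simplex, that it is acyclic.\<close>

definition exact_on :: "'c set \<Rightarrow> bool" where
  "exact_on Y \<longleftrightarrow> (\<forall>n. \<forall>c\<in>chains Y n. bd c = (\<lambda>_. 0) \<longrightarrow> (\<exists>b\<in>chains Y (Suc n). bd b = c))"

lemma exact_onE:
  assumes "exact_on Y" "c \<in> chains Y n" "bd c = (\<lambda>_. 0)"
  obtains b where "b \<in> chains Y (Suc n)" "bd b = c"
  using assms unfolding exact_on_def by blast

lemma chains_sum:
  assumes "\<And>x. x \<in> S \<Longrightarrow> a x \<noteq> 0 \<Longrightarrow> f x \<in> chains Y n"
  shows "(\<lambda>R. \<Sum>x\<in>S. a x * f x R) \<in> chains Y n"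
proof -
  have "R \<in> Y \<and> rank R = n" if "(\<Sum>x\<in>S. a x * f x R) \<noteq> 0" for R
  proof -
    from that obtain x where x: "x \<in> S" "a x * f x R \<noteq> 0"
      by (meson sum.neutral)
    then have "a x \<noteq> 0" "f x R \<noteq> 0" by auto
    with assms[OF x(1)] show ?thesis by (auto simp: chains_def)
  qed
  then show ?thesis by (auto simp: chains_def)
qed

lemma chains_add: "b \<in> chains Y n \<Longrightarrow> c \<in> chains Y n \<Longrightarrow> (\<lambda>R. b R + c R) \<in> chains Y n"
  by (force simp: chains_def)

lemma chains_diff: "b \<in> chains Y n \<Longrightarrow> c \<in> chains Y n \<Longrightarrow> (\<lambda>R. b R - c R) \<in> chains Y n"
  by (force simp: chains_def)

lemma chains_mono: "c \<in> chains Y n \<Longrightarrow> Y \<subseteq> Z \<Longrightarrow> c \<in> chains Z n"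
  by (auto simp: chains_def)

lemma bd_zero: "bd (\<lambda>_. 0) = (\<lambda>_. 0)"
  by (simp add: bd_def)

lemma bd_add: "bd (\<lambda>R. b R + c R) = (\<lambda>R. bd b R + bd c R)"
  by (simp add: bd_def sum.distrib algebra_simps)

lemma bd_diff: "bd (\<lambda>R. b R - c R) = (\<lambda>R. bd b R - bd c R)"
  by (simp add: bd_def sum_subtractf algebra_simps)

lemma bd_sum: "bd (\<lambda>R. \<Sum>x\<in>S. a x * f x R) = (\<lambda>R. \<Sum>x\<in>S. a x * bd (f x) R)"
proof (induction S rule: infinite_finite_induct)
  case (insert x S)
  have "bd (\<lambda>R. a x * f x R) = (\<lambda>R. a x * bd (f x) R)"
    by (simp add: bd_def sum_distrib_left mult.left_commute)
  with insert show ?case by (simp add: bd_add)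
qed (simp_all add: bd_zero)

lemma bd_face_sum: "bd (\<lambda>R. face_sum (\<lambda>L'. f L' R) L) = (\<lambda>R. face_sum (\<lambda>L'. bd (f L') R) L)"
  by (simp add: bd_def flip: face_sum_sum)

lemma sum_inc_inc:
  assumes "P \<in> X"
  shows "(\<Sum>Q\<in>X. inc P Q * (\<Sum>R\<in>X. inc Q R * h R)) = 0"
proof -
  have "(\<Sum>Q\<in>X. inc P Q * (\<Sum>R\<in>X. inc Q R * h R)) = (\<Sum>R\<in>X. (\<Sum>Q\<in>X. inc P Q * inc Q R) * h R)"
    by (subst sum_distrib_left, subst sum.swap) (simp add: sum_distrib_right mult.assoc)
  then show ?thesis using assms by (simp add: inc_inc)
qed

lemma bd_bd: "bd (bd c) = (\<lambda>_. 0)"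
proof
  fix R
  have "bd (bd c) R = (\<Sum>P\<in>X. c P * (\<Sum>Q\<in>X. inc P Q * inc Q R))"
    unfolding bd_def
    by (subst sum_distrib_left, subst sum.swap) (simp add: sum_distrib_left algebra_simps)
  then show "bd (bd c) R = 0" by (simp add: inc_inc)
qed

lemma bd_in_chains:
  assumes "closed_cells Y" "c \<in> chains Y n"
  shows "bd c \<in> chains Y (n - 1)"
proof -
  have "R \<in> Y \<and> rank R = n - 1" if "bd c R \<noteq> 0" for R
  proof -
    from that obtain P where P: "P \<in> X" "inc P R * c P \<noteq> 0"
      unfolding bd_def by (meson sum.neutral)
    then have "inc P R \<noteq> 0" "c P \<noteq> 0" by auto
    with P inc_rank[of P R] assms show ?thesis by (force simp: chains_def closed_cells_def)
  qed
  then show ?thesis by (auto simp: chains_def)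
qed

lemma bd_chains_0:
  assumes "c \<in> chains Y 0" shows "bd c = (\<lambda>_. 0)"
proof
  fix R
  have "inc P R * c P = 0" if "P \<in> X" for P
    using inc_rank[OF that, of R] assms by (cases "inc P R = 0"; cases "c P = 0") (auto simp: chains_def)
  then show "bd c R = 0" by (simp add: bd_def)
qed

lemma closed_cells_Int: "closed_cells Y \<Longrightarrow> closed_cells Z \<Longrightarrow> closed_cells (Y \<inter> Z)"
  by (auto simp: closed_cells_def)

lemma closed_cells_UN: "(\<And>i. i \<in> S \<Longrightarrow> closed_cells (C i)) \<Longrightarrow> closed_cells (\<Union>i\<in>S. C i)"
  unfolding closed_cells_def by blast

text \<open>The Mayer--Vietoris argument. A cycle is a sum \<open>a + b\<close> of chains of \<open>Y\<close> and of \<open>Z\<close>. The boundary of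
  \<open>a\<close>, which is minus that of \<open>b\<close>, lies in both subcomplexes, so it bounds a chain \<open>e\<close> of
  \<open>Y \<inter> Z\<close>. Now \<open>a - e\<close> and \<open>b + e\<close> are cycles of \<open>Y\<close> and of \<open>Z\<close>, and can be filled separately.\<close>

lemma exact_on_Un:
  assumes Y: "closed_cells Y" "exact_on Y" and Z: "closed_cells Z" "exact_on Z"
    and YZ: "exact_on (Y \<inter> Z)"
  shows "exact_on (Y \<union> Z)"
  unfolding exact_on_def
proof (intro allI ballI impI)
  fix n c assume c: "c \<in> chains (Y \<union> Z) n" "bd c = (\<lambda>_. 0)"
  define a where "a = (\<lambda>P. if P \<in> Y then c P else 0)"
  define b where "b = (\<lambda>P. if P \<in> Y then 0 else c P)"
  have a: "a \<in> chains Y n" and b: "b \<in> chains Z n"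
    using c by (auto simp: a_def b_def chains_def split: if_splits)
  have cab: "c = (\<lambda>P. a P + b P)" by (auto simp: a_def b_def)
  have ab: "bd a R = - bd b R" for R
    using c(2) unfolding cab bd_add by (metis eq_neg_iff_add_eq_0)
  obtain e where e: "e \<in> chains (Y \<inter> Z) n" "bd e = bd a"
  proof (cases n)
    case 0
    have "(\<lambda>_. 0) \<in> chains (Y \<inter> Z) n" by (simp add: chains_def)
    with that show ?thesis using bd_chains_0[OF a[unfolded 0]] by (auto simp: bd_zero)
  next
    case (Suc m)
    have "bd a \<in> chains Y m" "bd b \<in> chains Z m"
      using bd_in_chains[OF Y(1) a] bd_in_chains[OF Z(1) b] Suc by auto
    then have "bd a \<in> chains (Y \<inter> Z) m" by (auto simp: chains_def ab)
    then show ?thesis using exact_onE[OF YZ _ bd_bd, of a m] that Suc by blast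
  qed
  obtain a' where a': "a' \<in> chains Y (Suc n)" "bd a' = (\<lambda>P. a P - e P)"
    by (rule exact_onE[OF Y(2), of "\<lambda>P. a P - e P" n])
      (use a e in \<open>auto intro!: chains_diff intro: chains_mono simp: bd_diff\<close>)
  obtain b' where b': "b' \<in> chains Z (Suc n)" "bd b' = (\<lambda>P. b P + e P)"
    by (rule exact_onE[OF Z(2), of "\<lambda>P. b P + e P" n])
      (use b e in \<open>auto intro!: chains_add intro: chains_mono simp: bd_add ab\<close>)
  have "(\<lambda>P. a' P + b' P) \<in> chains (Y \<union> Z) (Suc n)"
    using a' b' by (auto intro!: chains_add intro: chains_mono)
  moreover have "bd (\<lambda>P. a' P + b' P) = c"
    by (simp add: bd_add a' b' cab)
  ultimately show "\<exists>b\<in>chains (Y \<union> Z) (Suc n). bd b = c" by blast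
qed

text \<open>The case of the nerve lemma in which the nerve is a full simplex. In the induction step, the new
  \<open>C v\<close> meets the union of the others in the union of the sets \<open>C v \<inter> C i\<close>, and the intersections of
  these are intersections of the original family that involve \<open>v\<close>.\<close>

lemma exact_on_UN:
  assumes "finite S" "S \<noteq> {}"
    and "\<And>i. i \<in> S \<Longrightarrow> closed_cells (C i)"
    and "\<And>A. A \<subseteq> S \<Longrightarrow> A \<noteq> {} \<Longrightarrow> exact_on (\<Inter>i\<in>A. C i)"
  shows "exact_on (\<Union>i\<in>S. C i)"
  using assms
proof (induction S arbitrary: C rule: finite_ne_induct)
  case (singleton v)
  from singleton.prems(2)[of "{v}"] show ?case by simp
next
  case (insert v S)
  have closed: "closed_cells (C v)" "closed_cells (\<Union>i\<in>S. C i)"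
    "\<And>i. i \<in> S \<Longrightarrow> closed_cells (C v \<inter> C i)"
    using insert.prems(1) by (auto intro: closed_cells_UN closed_cells_Int)
  have "exact_on (\<Union>i\<in>S. C i)"
    by (rule insert.IH) (use insert.prems in auto)
  moreover have "exact_on (C v \<inter> (\<Union>i\<in>S. C i))"
    unfolding Int_UN_distrib
  proof (rule insert.IH)
    fix A assume A: "A \<subseteq> S" "A \<noteq> {}"
    have "(\<Inter>i\<in>A. C v \<inter> C i) = (\<Inter>i\<in>insert v A. C i)" using A by auto
    with A insert.prems(2)[of "insert v A"] show "exact_on (\<Inter>i\<in>A. C v \<inter> C i)" by auto
  qed (use closed in auto)
  moreover have "exact_on (C v)" using insert.prems(2)[of "{v}"] by simp
  ultimately have "exact_on (C v \<union> (\<Union>i\<in>S. C i))"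
    using exact_on_Un[OF closed(1) _ closed(2)] by blast
  then show ?case by simp
qed

text \<open>The Lefschetz fixed point theorem for a complex without homology. The chain map \<open>f\<close> has a
  contracting homotopy \<open>H\<close>, that is, \<open>f\<close> is the sum of the boundary map after \<open>H\<close> and of \<open>H\<close> after the
  boundary map. Each product of an entry of \<open>H\<close> with an entry of the boundary matrix occurs once in
  the trace of either composition, at cells whose ranks differ by one, so the two cancel.\<close>

lemma alternating_trace_eq_0:
  assumes X: "exact_on X"
    and f: "\<And>P. P \<in> X \<Longrightarrow> f P \<in> chains X (rank P)"
    and bd_f: "\<And>P. P \<in> X \<Longrightarrow> bd (f P) = (\<lambda>R. \<Sum>Q\<in>X. inc P Q * f Q R)"
  shows "(\<Sum>P\<in>X. (-1) ^ rank P * f P P) = 0"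
proof -
  \<comment> \<open>The homotopy is chosen by recursion on the rank; with \<open>H\<close> extended linearly to chains,
    \<open>H P\<close> fills the difference of \<open>f P\<close> and \<open>H\<close> of the boundary of \<open>P\<close>, which is a cycle.\<close>
  have "\<exists>H. \<forall>P. P \<in> X \<longrightarrow> H P \<in> chains X (Suc (rank P)) \<and>
      bd (H P) = (\<lambda>R. f P R - (\<Sum>Q\<in>X. inc P Q * H Q R))"
  proof (rule dependent_wf_choice[OF wf_measure[of rank]])
    fix H H' :: "'c \<Rightarrow> 'c \<Rightarrow> 'k" and P r
    assume eq: "\<And>Q. (Q, P) \<in> Wellfounded.measure rank \<Longrightarrow> H Q = H' Q"
    have "inc P Q * H Q R = inc P Q * H' Q R" if "P \<in> X" for Q R
      using inc_rank[OF that, of Q] eq[of Q] by (cases "inc P Q = 0") auto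
    then show "(P \<in> X \<longrightarrow> r \<in> chains X (Suc (rank P)) \<and>
        bd r = (\<lambda>R. f P R - (\<Sum>Q\<in>X. inc P Q * H Q R))) =
      (P \<in> X \<longrightarrow> r \<in> chains X (Suc (rank P)) \<and>
        bd r = (\<lambda>R. f P R - (\<Sum>Q\<in>X. inc P Q * H' Q R)))"
      by auto
  next
    fix P and H :: "'c \<Rightarrow> 'c \<Rightarrow> 'k"
    assume IH: "\<And>Q. (Q, P) \<in> Wellfounded.measure rank \<Longrightarrow> Q \<in> X \<longrightarrow> H Q \<in> chains X (Suc (rank Q)) \<and>
        bd (H Q) = (\<lambda>R. f Q R - (\<Sum>T\<in>X. inc Q T * H T R))"
    show "\<exists>r. P \<in> X \<longrightarrow> r \<in> chains X (Suc (rank P)) \<and>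
        bd r = (\<lambda>R. f P R - (\<Sum>Q\<in>X. inc P Q * H Q R))"
    proof (cases "P \<in> X")
      case True
      have H: "H Q \<in> chains X (rank P)" "bd (H Q) = (\<lambda>R. f Q R - (\<Sum>T\<in>X. inc Q T * H T R))"
        if "inc P Q \<noteq> 0" for Q
        using IH[of Q] inc_rank[OF True that] inc_cell[OF True that] by auto
      let ?c = "\<lambda>R. f P R - (\<Sum>Q\<in>X. inc P Q * H Q R)"
      have c: "?c \<in> chains X (rank P)"
        by (intro chains_diff chains_sum f True H)
      have "inc P Q * bd (H Q) R = inc P Q * (f Q R - (\<Sum>T\<in>X. inc Q T * H T R))" for Q R
        by (cases "inc P Q = 0") (simp_all add: H(2))
      then have "bd ?c = (\<lambda>_. 0)"
        by (simp add: bd_diff bd_sum bd_f[OF True] right_diff_distrib sum_subtractf sum_inc_inc[OF True])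
      then obtain r where "r \<in> chains X (Suc (rank P))" "bd r = ?c"
        by (rule exact_onE[OF X c])
      then show ?thesis by blast
    qed simp
  qed
  then obtain H where H: "\<And>P. P \<in> X \<Longrightarrow> bd (H P) = (\<lambda>R. f P R - (\<Sum>Q\<in>X. inc P Q * H Q R))"
    by blast
  have "(\<Sum>P\<in>X. (-1) ^ rank P * f P P)
      = (\<Sum>P\<in>X. (-1) ^ rank P * (bd (H P) P + (\<Sum>Q\<in>X. inc P Q * H Q P)))"
    by (rule sum.cong) (auto simp: H)
  also have "\<dots> = (\<Sum>P\<in>X. \<Sum>Q\<in>X. (-1) ^ rank P * (inc Q P * H P Q))
      + (\<Sum>P\<in>X. \<Sum>Q\<in>X. (-1) ^ rank P * (inc P Q * H Q P))"
    by (simp add: bd_def distrib_left sum.distrib sum_distrib_left)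
  \<comment> \<open>The second trace, with the names of its two cells exchanged, is minus the first.\<close>
  also have "(\<Sum>P\<in>X. \<Sum>Q\<in>X. (-1) ^ rank P * (inc P Q * H Q P))
      = (\<Sum>P\<in>X. \<Sum>Q\<in>X. (-1) ^ rank Q * (inc Q P * H P Q))"
    by (rule sum.swap)
  also have "\<dots> = (\<Sum>P\<in>X. \<Sum>Q\<in>X. - ((-1) ^ rank P * (inc Q P * H P Q)))"
  proof (intro sum.cong refl)
    fix P Q assume "Q \<in> X"
    then show "(-1) ^ rank Q * (inc Q P * H P Q) = - ((-1) ^ rank P * (inc Q P * H P Q))"
      using inc_rank[of Q P] by (cases "inc Q P = 0") auto
  qed
  finally show ?thesis by (simp add: sum_negf)
qed

end

section \<open>Chain maps carried by a family of subcomplexes\<close>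

text \<open>The cell \<open>e\<close> of rank \<open>0\<close> is the empty cell of an augmented complex.\<close>

locale pointed_complex = based_complex X rank inc
  for X :: "'c set" and rank :: "'c \<Rightarrow> nat" and inc :: "'c \<Rightarrow> 'c \<Rightarrow> 'k::comm_ring_1" +
  fixes e :: 'c
  assumes e_cell: "e \<in> X" and rank_e: "rank e = 0"
begin

text \<open>The union of the family, enlarged by \<open>e\<close> so that the empty family also has a place for the image of
  the empty simplex. The subcomplexes of interest all contain \<open>e\<close>.\<close>

definition cells_of :: "('b \<Rightarrow> 'c set) \<Rightarrow> 'b set \<Rightarrow> 'c set" where
  "cells_of C S = insert e (\<Union>i\<in>S. C i)"

definition unit :: "'c \<Rightarrow> 'k" where
  "unit = (\<lambda>R. if R = e then 1 else 0)"

text \<open>An augmented chain map from the simplices with vertex set in \<open>N\<close> to the complex, such that the image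
  of a simplex lies in the union of the subcomplexes indexed by its vertices.\<close>

definition nerve_map :: "'b set set \<Rightarrow> ('b \<Rightarrow> 'c set) \<Rightarrow> ('b list \<Rightarrow> 'c \<Rightarrow> 'k) \<Rightarrow> bool" where
  "nerve_map N C g \<longleftrightarrow> g [] = unit \<and>
     (\<forall>L. set L \<in> N \<longrightarrow> g L \<in> chains (cells_of C (set L)) (length L) \<and>
        bd (g L) = (\<lambda>R. face_sum (\<lambda>L'. g L' R) L))"

lemma cells_of_mono: "S \<subseteq> T \<Longrightarrow> cells_of C S \<subseteq> cells_of C T"
  by (auto simp: cells_of_def)

lemma unit_chain: "unit \<in> chains (cells_of C S) 0"
  by (auto simp: unit_def chains_def cells_of_def rank_e)

text \<open>The method of acyclic carriers. The map is chosen by recursion on the length of the list: the boundary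
  prescribed for \<open>g L\<close> is a cycle, and for nonempty \<open>L\<close> the union that has to carry \<open>g L\<close> is exact.\<close>

lemma nerve_map_exists:
  fixes N :: "'b set set" and C :: "'b \<Rightarrow> 'c set"
  assumes down: "\<And>A A'. A \<subseteq> A' \<Longrightarrow> A' \<in> N \<Longrightarrow> A \<in> N"
    and C: "\<And>A i. A \<in> N \<Longrightarrow> i \<in> A \<Longrightarrow> closed_cells (C i) \<and> e \<in> C i"
    and exact: "\<And>A. A \<in> N \<Longrightarrow> A \<noteq> {} \<Longrightarrow> exact_on (\<Inter>i\<in>A. C i)"
  shows "\<exists>g. nerve_map N C g"
proof -
  have "\<exists>g. \<forall>L. (L = [] \<longrightarrow> g L = unit) \<and>
     (set L \<in> N \<longrightarrow> g L \<in> chains (cells_of C (set L)) (length L) \<and>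
        bd (g L) = (\<lambda>R. face_sum (\<lambda>L'. g L' R) L))"
  proof (rule dependent_wf_choice[OF wf_measure[of length]])
    fix g g' :: "'b list \<Rightarrow> 'c \<Rightarrow> 'k" and L r
    assume eq: "\<And>L'. (L', L) \<in> Wellfounded.measure length \<Longrightarrow> g L' = g' L'"
    have "face_sum (\<lambda>L'. g L' R) L = face_sum (\<lambda>L'. g' L' R) L" for R
      by (rule face_sum_cong) (simp add: eq)
    then show "((L = [] \<longrightarrow> r = unit) \<and>
     (set L \<in> N \<longrightarrow> r \<in> chains (cells_of C (set L)) (length L) \<and>
        bd r = (\<lambda>R. face_sum (\<lambda>L'. g L' R) L))) =
     ((L = [] \<longrightarrow> r = unit) \<and>
     (set L \<in> N \<longrightarrow> r \<in> chains (cells_of C (set L)) (length L) \<and>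
        bd r = (\<lambda>R. face_sum (\<lambda>L'. g' L' R) L)))"
      by simp
  next
    fix L :: "'b list" and g
    assume IH: "\<And>L'. (L', L) \<in> Wellfounded.measure length \<Longrightarrow> (L' = [] \<longrightarrow> g L' = unit) \<and>
     (set L' \<in> N \<longrightarrow> g L' \<in> chains (cells_of C (set L')) (length L') \<and>
        bd (g L') = (\<lambda>R. face_sum (\<lambda>L'. g L' R) L'))"
    show "\<exists>r. (L = [] \<longrightarrow> r = unit) \<and>
     (set L \<in> N \<longrightarrow> r \<in> chains (cells_of C (set L)) (length L) \<and>
        bd r = (\<lambda>R. face_sum (\<lambda>L'. g L' R) L))"
    proof (cases "L = [] \<or> set L \<notin> N")
      case True
      then show ?thesis
        using unit_chain bd_chains_0[OF unit_chain] by (intro exI[of _ unit]) auto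
    next
      case False
      then have L: "L \<noteq> []" "set L \<in> N" by auto
      have Y: "cells_of C (set L) = (\<Union>i\<in>set L. C i)"
        using L C[OF L(2)] by (cases L) (auto simp: cells_of_def)
      have ex: "exact_on (cells_of C (set L))"
        unfolding Y using L C[OF L(2)] by (intro exact_on_UN) (auto intro!: exact down[OF _ L(2)])
      let ?c = "\<lambda>R. face_sum (\<lambda>L'. g L' R) L"
      have g: "g L' \<in> chains (cells_of C (set L)) (length L - 1)"
        "bd (g L') = (\<lambda>R. face_sum (\<lambda>L'. g L' R) L')"
        if "length L = Suc (length L')" "set L' \<subseteq> set L" for L'
      proof -
        have "set L' \<in> N" using down[OF that(2) L(2)] .
        with IH[of L'] that show "bd (g L') = (\<lambda>R. face_sum (\<lambda>L'. g L' R) L')" by auto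
        show "g L' \<in> chains (cells_of C (set L)) (length L - 1)"
          using IH[of L'] that \<open>set L' \<in> N\<close> chains_mono[OF _ cells_of_mono[OF that(2)]] by auto
      qed
      have c: "?c \<in> chains (cells_of C (set L)) (length L - 1)"
      proof -
        have "R \<in> cells_of C (set L) \<and> rank R = length L - 1" if "?c R \<noteq> 0" for R
        proof -
          from that obtain L' where "length L = Suc (length L')" "set L' \<subseteq> set L" "g L' R \<noteq> 0"
            using face_sum_eq_0I[of L "\<lambda>L'. g L' R"] by blast
          with g(1)[of L'] show ?thesis by (auto simp: chains_def)
        qed
        then show ?thesis by (auto simp: chains_def)
      qed
      have "bd ?c = (\<lambda>R. face_sum (face_sum (\<lambda>L'. g L' R)) L)"
        unfolding bd_face_sum
        by (rule ext, rule face_sum_cong) (use g(2) in auto)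
      then have "bd ?c = (\<lambda>_. 0)" by (simp add: face_sum_face_sum)
      then obtain r where "r \<in> chains (cells_of C (set L)) (Suc (length L - 1))" "bd r = ?c"
        by (rule exact_onE[OF ex c])
      with L(1) show ?thesis by auto
    qed
  qed
  then obtain g where g: "\<And>L. (L = [] \<longrightarrow> g L = unit) \<and>
     (set L \<in> N \<longrightarrow> g L \<in> chains (cells_of C (set L)) (length L) \<and>
        bd (g L) = (\<lambda>R. face_sum (\<lambda>L'. g L' R) L))" by blast
  have "nerve_map N C g" unfolding nerve_map_def using g by blast
  then show ?thesis by blast
qed

text \<open>For a cell \<open>P\<close> of rank \<open>n\<close> this is the sum of \<open>g [\<iota> P\<^sub>1, ..., \<iota> P\<^sub>n] @ L\<close> over the complete flags
  \<open>e < P\<^sub>1 < ... < P\<^sub>n = P\<close>, weighted with the products of the incidence numbers. For empty \<open>L\<close> it is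
  the barycentric subdivision of \<open>P\<close>, followed by the simplicial map that \<open>\<iota>\<close> induces on it, followed by
  \<open>g\<close>. The list \<open>L\<close> collects the labels of the larger cells during the recursion.\<close>

primrec flag_map :: "('b list \<Rightarrow> 'c \<Rightarrow> 'k) \<Rightarrow> ('c \<Rightarrow> 'b) \<Rightarrow> nat \<Rightarrow> 'c \<Rightarrow> 'b list \<Rightarrow> 'c \<Rightarrow> 'k" where
  "flag_map g \<iota> 0 P L = g L"
| "flag_map g \<iota> (Suc n) P L = (\<lambda>R. \<Sum>Q\<in>X. inc P Q * flag_map g \<iota> n Q (\<iota> P # L) R)"

text \<open>The members of \<open>\<T> n\<close> are the sets of labels that may follow the labels of a flag of a cell of rank
  \<open>n\<close>. Adding the labels of the flag one by one leads to a member of \<open>\<T> 0\<close>, on which \<open>g\<close> is a nerve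
  map. As \<open>W\<close> decreases along faces, all labels of the flags of \<open>P\<close> belong to \<open>W P\<close>.\<close>

lemma flag_map_chain:
  assumes g: "nerve_map N C g"
    and step: "\<And>n P S. P \<in> X \<Longrightarrow> rank P = Suc n \<Longrightarrow> S \<in> \<T> (Suc n) \<Longrightarrow> insert (\<iota> P) S \<in> \<T> n"
    and base: "\<T> 0 \<subseteq> N"
    and W: "\<And>P. P \<in> X \<Longrightarrow> rank P \<noteq> 0 \<Longrightarrow> \<iota> P \<in> W P"
    and W_mono: "\<And>P Q. P \<in> X \<Longrightarrow> inc P Q \<noteq> 0 \<Longrightarrow> W Q \<subseteq> W P"
  shows "P \<in> X \<Longrightarrow> rank P = n \<Longrightarrow> set L \<in> \<T> n \<Longrightarrow>
    flag_map g \<iota> n P L \<in> chains (cells_of C (W P \<union> set L)) (n + length L)"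
proof (induction n arbitrary: P L)
  case 0
  then have "g L \<in> chains (cells_of C (set L)) (length L)"
    using g base by (auto simp: nerve_map_def)
  then show ?case using chains_mono[OF _ cells_of_mono[of "set L"]] by simp
next
  case (Suc n)
  have "flag_map g \<iota> n Q (\<iota> P # L) \<in> chains (cells_of C (W P \<union> set L)) (Suc n + length L)"
    if "inc P Q \<noteq> 0" for Q
  proof -
    have "Q \<in> X" "rank Q = n"
      using that inc_cell[of P Q] inc_rank[of P Q] Suc.prems by auto
    moreover have "set (\<iota> P # L) \<in> \<T> n" using step Suc.prems by simp
    ultimately have "flag_map g \<iota> n Q (\<iota> P # L)
        \<in> chains (cells_of C (W Q \<union> set (\<iota> P # L))) (n + length (\<iota> P # L))"
      by (rule Suc.IH)
    moreover have "W Q \<union> set (\<iota> P # L) \<subseteq> W P \<union> set L"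
      using W[of P] W_mono[of P Q] that Suc.prems by auto
    ultimately show ?thesis using chains_mono[OF _ cells_of_mono] by fastforce
  qed
  then show ?case by (auto intro: chains_sum)
qed

text \<open>The flag map is a chain map for empty \<open>L\<close>; the general form is needed for the induction. A face of a
  labelled flag that omits the label of a member below the top cancels, because the boundary map squares
  to zero. What remains are the faces that omit a vertex of \<open>L\<close>, and those that omit the label of \<open>P\<close>,
  which add up to the flag maps of the facets of \<open>P\<close>.\<close>

lemma bd_flag_map:
  assumes g: "nerve_map N C g"
    and step: "\<And>n P S. P \<in> X \<Longrightarrow> rank P = Suc n \<Longrightarrow> S \<in> \<T> (Suc n) \<Longrightarrow> insert (\<iota> P) S \<in> \<T> n"
    and base: "\<T> 0 \<subseteq> N"
  shows "P \<in> X \<Longrightarrow> rank P = n \<Longrightarrow> set L \<in> \<T> n \<Longrightarrow> bd (flag_map g \<iota> n P L) R =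
    face_sum (\<lambda>L'. flag_map g \<iota> n P L' R) L
    + (-1) ^ length L * (\<Sum>Q\<in>X. inc P Q * flag_map g \<iota> (n - 1) Q L R)"
proof (induction n arbitrary: P L)
  case 0
  have "inc P Q = 0" for Q using inc_rank[of P Q] 0 by force
  then show ?case using g base 0 by (auto simp: nerve_map_def)
next
  case (Suc n)
  let ?v = "\<iota> P"
  have IH: "inc P Q * bd (flag_map g \<iota> n Q (?v # L)) R =
      inc P Q * (face_sum (\<lambda>L'. flag_map g \<iota> n Q L' R) (?v # L)
      + (-1) ^ length (?v # L) * (\<Sum>T\<in>X. inc Q T * flag_map g \<iota> (n - 1) T (?v # L) R))" for Q
  proof (cases "inc P Q = 0")
    case False
    then have "Q \<in> X" "rank Q = n"
      using inc_cell[of P Q] inc_rank[of P Q] Suc.prems by auto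
    moreover have "set (?v # L) \<in> \<T> n" using step Suc.prems by simp
    ultimately show ?thesis by (simp only: Suc.IH)
  qed simp
  have "bd (flag_map g \<iota> (Suc n) P L) R
      = (\<Sum>Q\<in>X. inc P Q * bd (flag_map g \<iota> n Q (?v # L)) R)"
    by (simp add: bd_sum)
  also have "\<dots> = (-1) ^ length L * (\<Sum>Q\<in>X. inc P Q * flag_map g \<iota> n Q L R)
      + (\<Sum>Q\<in>X. inc P Q * face_sum (\<lambda>L'. flag_map g \<iota> n Q (?v # L') R) L)
      - (-1) ^ length L *
        (\<Sum>Q\<in>X. inc P Q * (\<Sum>T\<in>X. inc Q T * flag_map g \<iota> (n - 1) T (?v # L) R))"
    unfolding IH
    by (simp add: distrib_left right_diff_distrib sum.distrib sum_subtractf sum_distrib_left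
        sum_negf mult.left_commute)
  also have "\<dots> = (-1) ^ length L * (\<Sum>Q\<in>X. inc P Q * flag_map g \<iota> n Q L R)
      + face_sum (\<lambda>L'. flag_map g \<iota> (Suc n) P L' R) L"
    using Suc.prems by (simp add: sum_inc_inc face_sum_sum)
  finally show ?case by simp
qed

section \<open>A colourful Helly theorem for based complexes\<close>

text \<open>Suppose that all these intersections are exact. Then there is a nerve map \<open>g\<close> on the partial
  transversals of the colour classes. Label a cell \<open>P\<close> with an index of colour \<open>rank P\<close> whose subcomplex
  does not contain \<open>P\<close>. The ranks in a flag are distinct, so its labels form a partial transversal, and
  the flag map is a chain map from \<open>X\<close> to itself. It sends \<open>P\<close> to a chain on subcomplexes that do not
  contain \<open>P\<close>, so its only nonzero diagonal entry is the one at \<open>e\<close>, which is \<open>1\<close>. This contradicts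
  the vanishing of the alternating trace.\<close>

theorem colourful_cover:
  fixes C :: "'b \<Rightarrow> 'c set" and V :: "nat \<Rightarrow> 'b set"
  assumes X: "exact_on X"
    and ranks: "\<And>P. P \<in> X \<Longrightarrow> P \<noteq> e \<Longrightarrow> rank P \<in> {1..m}"
    and C: "\<And>p i. p \<in> {1..m} \<Longrightarrow> i \<in> V p \<Longrightarrow> closed_cells (C i) \<and> e \<in> C i"
    and miss: "\<And>p P. p \<in> {1..m} \<Longrightarrow> P \<in> X \<Longrightarrow> P \<noteq> e \<Longrightarrow> \<exists>i\<in>V p. P \<notin> C i"
    and nonempty: "\<And>p. p \<in> {1..m} \<Longrightarrow> V p \<noteq> {}"
  shows "\<exists>i A. (\<forall>p\<in>{1..m}. i p \<in> V p) \<and> A \<subseteq> i ` {1..m} \<and> A \<noteq> {} \<and> \<not> exact_on (\<Inter>i\<in>A. C i)"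
proof (rule ccontr)
  assume contra: "\<not> ?thesis"
  \<comment> \<open>The sets of indices with distinct colours larger than \<open>n\<close>.\<close>
  define \<T> where "\<T> n = {A. \<exists>i. (\<forall>p\<in>{1..m}. i p \<in> V p) \<and> A \<subseteq> i ` {n<..m}}" for n
  have "\<exists>g. nerve_map (\<T> 0) C g"
  proof (rule nerve_map_exists)
    show "A \<subseteq> A' \<Longrightarrow> A' \<in> \<T> 0 \<Longrightarrow> A \<in> \<T> 0" for A A'
      unfolding \<T>_def by blast
    have *: "{0<..m} = {1..m}" by auto
    show "closed_cells (C i) \<and> e \<in> C i" if A: "A \<in> \<T> 0" "i \<in> A" for A i
    proof -
      from A obtain p where "p \<in> {1..m}" "i \<in> V p" unfolding \<T>_def * by blast
      then show ?thesis by (rule C)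
    qed
    show "exact_on (\<Inter>i\<in>A. C i)" if "A \<in> \<T> 0" "A \<noteq> {}" for A
      using contra that unfolding \<T>_def * by blast
  qed
  then obtain g where g: "nerve_map (\<T> 0) C g" ..
  have "\<forall>P\<in>X. P \<noteq> e \<longrightarrow> (\<exists>i\<in>V (rank P). P \<notin> C i)"
    using miss ranks by blast
  then obtain \<iota> where \<iota>: "\<And>P. P \<in> X \<Longrightarrow> P \<noteq> e \<Longrightarrow> \<iota> P \<in> V (rank P) \<and> P \<notin> C (\<iota> P)"
    by metis
  have step: "insert (\<iota> P) S \<in> \<T> n" if "P \<in> X" "rank P = Suc n" "S \<in> \<T> (Suc n)" for n P S
  proof -
    from that(3) obtain i where i: "\<forall>p\<in>{1..m}. i p \<in> V p" "S \<subseteq> i ` {Suc n<..m}"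
      by (auto simp: \<T>_def)
    have "P \<noteq> e" using that rank_e by auto
    then have "\<iota> P \<in> V (Suc n)" "Suc n \<le> m" using \<iota>[of P] ranks[of P] that by auto
    let ?j = "i(Suc n := \<iota> P)"
    have "\<forall>p\<in>{1..m}. ?j p \<in> V p" using i(1) \<open>\<iota> P \<in> V (Suc n)\<close> by auto
    moreover have "{n<..m} = insert (Suc n) {Suc n<..m}" using \<open>Suc n \<le> m\<close> by auto
    then have "insert (\<iota> P) S \<subseteq> ?j ` {n<..m}" using i(2) by auto
    ultimately show ?thesis unfolding \<T>_def by blast
  qed
  define W where "W P = {i. (\<exists>p\<in>{1..m}. i \<in> V p) \<and> P \<notin> C i}" for P
  have \<iota>_W: "\<iota> P \<in> W P" if "P \<in> X" "rank P \<noteq> 0" for P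
  proof -
    have "P \<noteq> e" using that rank_e by auto
    with that show ?thesis using \<iota> ranks unfolding W_def by blast
  qed
  have W_mono: "W Q \<subseteq> W P" if "P \<in> X" "inc P Q \<noteq> 0" for P Q
  proof
    fix i assume "i \<in> W Q"
    then obtain p where p: "p \<in> {1..m}" "i \<in> V p" and i: "Q \<notin> C i" by (auto simp: W_def)
    from C[OF p] i that have "P \<notin> C i" by (auto simp: closed_cells_def)
    with p show "i \<in> W P" by (auto simp: W_def)
  qed
  have "\<forall>p\<in>{1..m}. \<exists>i. i \<in> V p" using nonempty by blast
  then obtain j where "\<forall>p\<in>{1..m}. j p \<in> V p" by metis
  then have empty: "set [] \<in> \<T> n" for n
    unfolding \<T>_def by auto
  define f where "f P = flag_map g \<iota> (rank P) P []" for P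
  have f_chain: "f P \<in> chains (cells_of C (W P)) (rank P)" if "P \<in> X" for P
    using flag_map_chain[where \<T> = \<T> and W = W, OF g step order_refl \<iota>_W W_mono that refl empty]
    by (simp add: f_def)
  have "(\<Sum>P\<in>X. (-1) ^ rank P * f P P) = 0"
  proof (rule alternating_trace_eq_0[where f = f, OF X])
    fix P assume P: "P \<in> X"
    have "cells_of C (W P) \<subseteq> X"
    proof -
      have "C i \<subseteq> X" if "i \<in> W P" for i
        using C that unfolding W_def closed_cells_def by blast
      then show ?thesis using e_cell by (auto simp: cells_of_def)
    qed
    with f_chain[OF P] show "f P \<in> chains X (rank P)" by (rule chains_mono)
    show "bd (f P) = (\<lambda>R. \<Sum>Q\<in>X. inc P Q * f Q R)"
    proof
      fix R
      have "bd (f P) R = (\<Sum>Q\<in>X. inc P Q * flag_map g \<iota> (rank P - 1) Q [] R)"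
        using bd_flag_map[where \<T> = \<T>, OF g step order_refl P refl empty] by (simp add: f_def)
      also have "\<dots> = (\<Sum>Q\<in>X. inc P Q * f Q R)"
      proof (rule sum.cong)
        fix Q show "inc P Q * flag_map g \<iota> (rank P - 1) Q [] R = inc P Q * f Q R"
          using inc_rank[OF P, of Q] by (cases "inc P Q = 0") (auto simp: f_def)
      qed simp
      finally show "bd (f P) R = (\<Sum>Q\<in>X. inc P Q * f Q R)" .
    qed
  qed
  moreover have "f P P = 0" if "P \<in> X" "P \<noteq> e" for P
  proof -
    have "P \<notin> cells_of C (W P)" using that by (auto simp: cells_of_def W_def)
    with f_chain[OF that(1)] show ?thesis by (auto simp: chains_def)
  qed
  moreover have "f e e = 1"
    using g by (simp add: f_def rank_e nerve_map_def unit_def)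
  ultimately show False
    by (simp add: sum.remove[OF finite_cells e_cell] rank_e)
qed

end

section \<open>Monomials in ideals generated by variables\<close>

lemma keys_add_nat:
  "Poly_Mapping.keys (a + b :: 'b \<Rightarrow>\<^sub>0 nat) = Poly_Mapping.keys a \<union> Poly_Mapping.keys b"
  by (auto simp: in_keys_iff lookup_add)

lemma keys_sum_single_nat:
  "finite S \<Longrightarrow> Poly_Mapping.keys (\<Sum>i\<in>S. Poly_Mapping.single i (1::nat)) = S"
  by (induction S rule: finite_induct) (auto simp: keys_add_nat)

lemma keys_mult_subsetD:
  assumes "m \<in> Poly_Mapping.keys (f * g :: ('b, 'k::field) mpoly)"
  obtains a b where "a \<in> Poly_Mapping.keys f" "b \<in> Poly_Mapping.keys g"
    "Poly_Mapping.keys m = Poly_Mapping.keys a \<union> Poly_Mapping.keys b"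
  using subsetD[OF keys_mult assms] by (auto simp: keys_add_nat)

lemma keys_uminus: "Poly_Mapping.keys (- f :: ('b, 'k::field) mpoly) = Poly_Mapping.keys f"
  by (auto simp: in_keys_iff)

lemma ring_poly_ring: "ring (poly_ring B :: ('b, 'k::field) mpoly ring)"
proof (rule ringI)
  show "abelian_group (poly_ring B :: ('b, 'k) mpoly ring)"
  proof (rule abelian_groupI)
    fix x y :: "('b, 'k) mpoly"
    assume "x \<in> carrier (poly_ring B)" "y \<in> carrier (poly_ring B)"
    then show "x \<oplus>\<^bsub>poly_ring B\<^esub> y \<in> carrier (poly_ring B)"
      using keys_add[of x y] by (auto simp: poly_ring_def)
  next
    fix x :: "('b, 'k) mpoly" assume "x \<in> carrier (poly_ring B)"
    then have "- x \<in> carrier (poly_ring B)" by (simp add: poly_ring_def keys_uminus)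
    then show "\<exists>y\<in>carrier (poly_ring B). y \<oplus>\<^bsub>poly_ring B\<^esub> x = \<zero>\<^bsub>poly_ring B\<^esub>"
      by (intro bexI[of _ "- x"]) (simp_all add: poly_ring_def)
  qed (auto simp: poly_ring_def algebra_simps)
  show "Group.monoid (poly_ring B :: ('b, 'k) mpoly ring)"
  proof (rule monoidI)
    fix x y :: "('b, 'k) mpoly"
    assume "x \<in> carrier (poly_ring B)" "y \<in> carrier (poly_ring B)"
    then show "x \<otimes>\<^bsub>poly_ring B\<^esub> y \<in> carrier (poly_ring B)"
      by (fastforce simp: poly_ring_def elim: keys_mult_subsetD)
  qed (auto simp: poly_ring_def algebra_simps)
qed (auto simp: poly_ring_def algebra_simps)

text \<open>This ideal contains the variables in \<open>F\<close>, so it bounds \<open>var_ideal B F\<close> from above and excludes every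
  monomial without a variable in \<open>F\<close>. It is closed under multiplication because exponents in \<open>nat\<close>
  cannot cancel.\<close>

lemma ideal_of_touching_monomials:
  "ideal {f \<in> carrier (poly_ring B). \<forall>m\<in>Poly_Mapping.keys f. Poly_Mapping.keys m \<inter> F \<noteq> {}}
     (poly_ring B :: ('b, 'k::field) mpoly ring)" (is "ideal ?J ?R")
proof (rule idealI[OF ring_poly_ring])
  interpret ring ?R by (rule ring_poly_ring)
  show "subgroup ?J (add_monoid ?R)"
  proof (rule group.subgroupI[OF a_group])
    show "?J \<subseteq> carrier (add_monoid ?R)" by auto
    show "?J \<noteq> {}"
      by (rule ex_in_conv[THEN iffD1], rule exI[of _ 0]) (simp add: poly_ring_def)
    fix x assume x: "x \<in> ?J"
    then have "- x \<in> ?J" by (simp add: poly_ring_def keys_uminus)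
    moreover from this x have "\<ominus>\<^bsub>?R\<^esub> x = - x"
      by (intro minus_equality) (auto simp: poly_ring_def)
    ultimately show "inv\<^bsub>add_monoid ?R\<^esub> x \<in> ?J" by (simp add: a_inv_def)
  next
    fix x y assume xy: "x \<in> ?J" "y \<in> ?J"
    then have "x \<oplus>\<^bsub>?R\<^esub> y \<in> carrier ?R" by (intro a_closed) auto
    then show "x \<otimes>\<^bsub>add_monoid ?R\<^esub> y \<in> ?J"
      using xy keys_add[of x y] by (auto simp: poly_ring_def)
  qed
next
  interpret ring ?R by (rule ring_poly_ring)
  fix a x assume a: "a \<in> ?J" and x: "x \<in> carrier ?R"
  then have "x \<otimes>\<^bsub>?R\<^esub> a \<in> carrier ?R" by (intro m_closed) auto
  moreover have "Poly_Mapping.keys m \<inter> F \<noteq> {}" if "m \<in> Poly_Mapping.keys (x * a)" for m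
    using that a by (fastforce elim: keys_mult_subsetD)
  ultimately show *: "x \<otimes>\<^bsub>?R\<^esub> a \<in> ?J" by (simp add: poly_ring_def)
  have "a \<otimes>\<^bsub>?R\<^esub> x = x \<otimes>\<^bsub>?R\<^esub> a" by (simp add: poly_ring_def mult.commute)
  with * show "a \<otimes>\<^bsub>?R\<^esub> x \<in> ?J" by simp
qed

lemma prod_var:
  "finite S \<Longrightarrow>
    (\<Prod>i\<in>S. var i :: ('b, 'k::field) mpoly) = Poly_Mapping.single (\<Sum>i\<in>S. Poly_Mapping.single i 1) 1"
  by (induction S rule: finite_induct) (auto simp: var_def mult_single)

lemma prod_var_carrier:
  "finite S \<Longrightarrow> S \<subseteq> B \<Longrightarrow> (\<Prod>i\<in>S. var i :: ('b, 'k::field) mpoly) \<in> carrier (poly_ring B)"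
  by (simp add: prod_var poly_ring_def keys_sum_single_nat del: One_nat_def)

lemma prod_var_in_var_ideal_iff:
  assumes "finite S" "S \<subseteq> B" "F \<subseteq> B"
  shows "(\<Prod>i\<in>S. var i :: ('b, 'k::field) mpoly) \<in> var_ideal B F \<longleftrightarrow> S \<inter> F \<noteq> {}"
proof
  interpret ring "poly_ring B :: ('b, 'k) mpoly ring" by (rule ring_poly_ring)
  let ?J = "{f \<in> carrier (poly_ring B). \<forall>m\<in>Poly_Mapping.keys f. Poly_Mapping.keys m \<inter> F \<noteq> {}}
    :: ('b, 'k) mpoly set"
  have "var ` F \<subseteq> ?J" using \<open>F \<subseteq> B\<close> by (auto simp: var_def poly_ring_def)
  then have "var_ideal B F \<subseteq> ?J"
    unfolding var_ideal_def by (intro genideal_minimal ideal_of_touching_monomials)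
  moreover assume "(\<Prod>i\<in>S. var i :: ('b, 'k) mpoly) \<in> var_ideal B F"
  ultimately show "S \<inter> F \<noteq> {}"
    using \<open>finite S\<close> by (auto simp: prod_var keys_sum_single_nat simp del: One_nat_def)
next
  interpret ring "poly_ring B :: ('b, 'k) mpoly ring" by (rule ring_poly_ring)
  assume "S \<inter> F \<noteq> {}"
  then obtain i where i: "i \<in> S" "i \<in> F" by blast
  have gens: "var ` F \<subseteq> carrier (poly_ring B :: ('b, 'k) mpoly ring)"
    using \<open>F \<subseteq> B\<close> by (auto simp: var_def poly_ring_def)
  interpret I: ideal "var_ideal B F" "poly_ring B :: ('b, 'k) mpoly ring"
    unfolding var_ideal_def by (rule genideal_ideal[OF gens])
  have "var i \<in> (var_ideal B F :: ('b, 'k) mpoly set)"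
    using genideal_self[OF gens] i by (auto simp: var_ideal_def)
  moreover have "(\<Prod>j\<in>S - {i}. var j :: ('b, 'k) mpoly) \<in> carrier (poly_ring B)"
    by (rule prod_var_carrier) (use assms in auto)
  ultimately have "var i \<otimes>\<^bsub>poly_ring B\<^esub> (\<Prod>j\<in>S - {i}. var j) \<in> (var_ideal B F :: ('b, 'k) mpoly set)"
    by (rule I.I_r_closed)
  then show "(\<Prod>i\<in>S. var i :: ('b, 'k) mpoly) \<in> var_ideal B F"
    using prod.remove[OF \<open>finite S\<close> i(1), of "var :: 'b \<Rightarrow> ('b, 'k) mpoly"] by (simp add: poly_ring_def)
qed

lemma I_Delta_subset_var_ideal_iff:
  assumes "finite B" "F \<subseteq> B"
  shows "(I_Delta X B C :: ('b, 'k::field) mpoly set) \<subseteq> var_ideal B F \<longleftrightarrow>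
    (\<forall>v\<in>vertices X. \<exists>i\<in>F. v \<notin> vertices (C i))"
proof -
  interpret ring "poly_ring B :: ('b, 'k) mpoly ring" by (rule ring_poly_ring)
  let ?g = "\<lambda>v. (\<Prod>i\<in>{i\<in>B. v \<notin> vertices (C i)}. var i) :: ('b, 'k) mpoly"
  have gens: "?g ` vertices X \<subseteq> carrier (poly_ring B)"
    using assms by (auto intro!: prod_var_carrier)
  have "var ` F \<subseteq> carrier (poly_ring B :: ('b, 'k) mpoly ring)"
    using \<open>F \<subseteq> B\<close> by (auto simp: var_def poly_ring_def)
  then have "ideal (var_ideal B F) (poly_ring B :: ('b, 'k) mpoly ring)"
    unfolding var_ideal_def by (rule genideal_ideal)
  then have "(I_Delta X B C :: ('b, 'k) mpoly set) \<subseteq> var_ideal B F \<longleftrightarrow>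
      ?g ` vertices X \<subseteq> var_ideal B F"
    unfolding I_Delta_def using genideal_self[OF gens] genideal_minimal by blast
  also have "\<dots> \<longleftrightarrow> (\<forall>v\<in>vertices X. \<exists>i\<in>F. v \<notin> vertices (C i))"
    using assms by (auto simp: image_subset_iff prod_var_in_var_ideal_iff)
  finally show ?thesis .
qed

section \<open>Acyclic polyhedral complexes\<close>

text \<open>The shift by one gives the empty cell, of affine dimension \<open>-1\<close>, the rank \<open>0\<close>.\<close>

definition cell_rank :: "'n::euclidean_space set \<Rightarrow> nat" where
  "cell_rank P = nat (aff_dim P + 1)"

lemma cell_rank_eq_iff: "cell_rank P = n \<longleftrightarrow> aff_dim P = int n - 1"
  using aff_dim_geq[of P] by (auto simp: cell_rank_def)

lemma incidence_nonzero:
  "incidence P Q \<noteq> 0 \<Longrightarrow> Q face_of P \<and> aff_dim Q = aff_dim P - 1"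
  by (auto simp: incidence_def split: if_splits)

locale acyclic_polyhedral_complex =
  fixes X :: "'n::euclidean_space set set" and K :: "'k::field itself"
  assumes polyhedral: "polyhedral_complex X"
    and acyclic: "acyclic_over K X"
begin

lemma finite_X: "finite X" and empty_in_X: "{} \<in> X"
  and face_X: "P \<in> X \<Longrightarrow> F face_of P \<Longrightarrow> F \<in> X"
  using polyhedral unfolding polyhedral_complex_def by blast+

text \<open>Vanishing reduced homology is an equality of cycles and boundaries, so it says in particular that
  boundaries are cycles. For the boundary of a single cell this is the claim.\<close>

lemma incidence_incidence:
  assumes "P \<in> X"
  shows "(\<Sum>Q\<in>X. of_int (incidence P Q) * of_int (incidence Q R) :: 'k) = 0"
proof -
  let ?c = "\<lambda>T. if T = P then 1 else 0 :: 'k"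
  let ?p = "aff_dim P - 1"
  have bd: "cell_boundary X ?c = (\<lambda>Q. of_int (incidence P Q))"
    using finite_X assms by (simp add: cell_boundary_def if_distrib[of "(*) _"] sum.delta cong: if_cong)
  have "?c \<in> cell_chains X (?p + 1)" using assms by (auto simp: cell_chains_def)
  then have "cell_boundary X ?c \<in> reduced_boundaries X ?p" by (auto simp: reduced_boundaries_def)
  then have "cell_boundary X ?c \<in> reduced_cycles X ?p"
    using acyclic by (auto simp: acyclic_over_def reduced_homology_zero_def)
  then have "cell_boundary X (\<lambda>Q. of_int (incidence P Q) :: 'k) = (\<lambda>_. 0)"
    by (simp add: bd reduced_cycles_def)
  from fun_cong[OF this, of R] show ?thesis by (simp add: cell_boundary_def mult.commute)
qed

sublocale pointed_complex X cell_rank "\<lambda>P Q. of_int (incidence P Q) :: 'k" "{}"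
proof
  fix P Q assume P: "P \<in> X" "of_int (incidence P Q) \<noteq> (0 :: 'k)"
  then have "incidence P Q \<noteq> 0" by auto
  then have Q: "Q face_of P" "aff_dim Q = aff_dim P - 1" using incidence_nonzero by auto
  show "Q \<in> X" using face_X P(1) Q(1) .
  show "cell_rank P = Suc (cell_rank Q)"
    using Q(2) cell_rank_eq_iff[of Q "cell_rank Q"] by (simp add: cell_rank_eq_iff)
qed (use finite_X empty_in_X incidence_incidence in \<open>auto simp: cell_rank_eq_iff\<close>)

lemma closed_cellsI:
  assumes "Y \<subseteq> X" "\<And>P F. P \<in> Y \<Longrightarrow> F face_of P \<Longrightarrow> F \<in> Y"
  shows "closed_cells Y"
  using assms incidence_nonzero unfolding closed_cells_def by (metis of_int_0)

lemma cell_chains_eq: "cell_chains Y (int n - 1) = chains Y n"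
  by (auto simp: cell_chains_def chains_def cell_rank_eq_iff)

lemma cell_boundary_eq:
  assumes "Y \<subseteq> X" "c \<in> chains Y n"
  shows "cell_boundary Y c = bd c"
proof
  fix Q
  show "cell_boundary Y c Q = bd c Q"
    unfolding cell_boundary_def bd_def
    by (rule sum.mono_neutral_left) (use assms finite_X in \<open>auto simp: chains_def\<close>)
qed

lemma exact_on_if_acyclic:
  assumes "Y \<subseteq> X" "acyclic_over K Y"
  shows "exact_on Y"
  unfolding exact_on_def
proof (intro allI ballI impI)
  fix n c assume c: "c \<in> chains Y n" "bd c = (\<lambda>_. 0)"
  then have "c \<in> reduced_cycles Y (int n - 1)"
    using cell_boundary_eq[OF assms(1)] by (auto simp: reduced_cycles_def cell_chains_eq)
  then have "c \<in> reduced_boundaries Y (int n - 1)"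
    using assms(2) by (auto simp: acyclic_over_def reduced_homology_zero_def)
  then have "c \<in> cell_boundary Y ` chains Y (Suc n)"
    using cell_chains_eq[of Y "Suc n"] by (simp add: reduced_boundaries_def)
  then show "\<exists>b\<in>chains Y (Suc n). bd b = c"
    using cell_boundary_eq[OF assms(1)] by auto
qed

end

lemma induced_subcomplexD:
  assumes "polyhedral_complex X" "induced_subcomplex X Y"
  shows "Y \<subseteq> X" "{} \<in> Y" "\<And>P F. P \<in> Y \<Longrightarrow> F face_of P \<Longrightarrow> F \<in> Y"
proof -
  from assms(2) obtain V where Y: "Y = induced_by X V" by (auto simp: induced_subcomplex_def)
  show "Y \<subseteq> X" "{} \<in> Y"
    using assms(1) by (auto simp: Y induced_by_def polyhedral_complex_def)
  fix P F assume "P \<in> Y" "F face_of P"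
  then show "F \<in> Y"
    using assms(1) unfolding Y induced_by_def polyhedral_complex_def
    by (auto simp: extreme_point_of_face)
qed

section \<open>Colourful ideals\<close>

text \<open>A nonempty polytope has an extreme point, so a nonempty cell in the intersection has a vertex, which
  lies in all the subcomplexes too.\<close>

lemma no_common_vertex_iff:
  assumes X: "polyhedral_complex X" and C: "\<And>i. i \<in> F \<Longrightarrow> induced_subcomplex X (C i)"
  shows "(\<forall>v\<in>vertices X. \<exists>i\<in>F. v \<notin> vertices (C i)) \<longleftrightarrow> \<Union>(subcomplex_Inter X C F) = {}"
proof
  assume no_vertex: "\<forall>v\<in>vertices X. \<exists>i\<in>F. v \<notin> vertices (C i)"
  have "P = {}" if P: "P \<in> subcomplex_Inter X C F" for P
  proof (rule ccontr)
    assume "P \<noteq> {}"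
    have "P \<in> X" "polytope P" using P X by (auto simp: subcomplex_Inter_def polyhedral_complex_def)
    then obtain v where v: "v extreme_point_of P"
      using extreme_point_exists_convex[of P] \<open>P \<noteq> {}\<close> polytope_imp_compact polytope_imp_convex
      by blast
    then have face: "{v} face_of P" by (simp add: face_of_singleton)
    have "v \<in> vertices X"
      using X face \<open>P \<in> X\<close> unfolding vertices_def polyhedral_complex_def by blast
    with no_vertex obtain i where i: "i \<in> F" "v \<notin> vertices (C i)" by blast
    moreover have "P \<in> C i" using P i by (auto simp: subcomplex_Inter_def)
    ultimately show False
      using induced_subcomplexD(3)[OF X C _ face] by (auto simp: vertices_def)
  qed
  then show "\<Union>(subcomplex_Inter X C F) = {}" by blast
qed (force simp: vertices_def subcomplex_Inter_def)

theorem theorem3p3: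
  fixes X :: "'n::euclidean_space set set"
    and d :: nat
    and B :: "'b set"
    and Bp :: "nat \<Rightarrow> 'b set"
    and C :: "'b \<Rightarrow> 'n set set"
  assumes "polyhedral_complex X"
    and "complex_dim X = int d"
    and "reduced_homology_zero TYPE('k::field) X (int d)"
    and "finite B"
    and "B = (\<Union>p\<in>{1..d+1}. Bp p)"
    and "disjoint_family_on Bp {1..d+1}"
    and "\<And>i. i \<in> B \<Longrightarrow> induced_subcomplex X (C i)"
    and "\<And>A. A \<subseteq> B \<Longrightarrow>
           \<Union>(subcomplex_Inter X C A) = {} \<or> acyclic_over TYPE('k) (subcomplex_Inter X C A)"
    and "\<And>p. p \<in> {1..d+1} \<Longrightarrow> (I_Delta X B C :: ('b, 'k) mpoly set) \<subseteq> var_ideal B (Bp p)"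
  shows "\<exists>i. (\<forall>p\<in>{1..d+1}. i p \<in> Bp p) \<and>
             (I_Delta X B C :: ('b, 'k) mpoly set) \<subseteq> var_ideal B (i ` {1..d+1})"
proof -
  note X = assms(1) and B = assms(5) and C = assms(7) and acyc = assms(8)
  have Bp: "Bp p \<subseteq> B" if "p \<in> {1..d+1}" for p using B that by blast
  have dim_le: "aff_dim P \<le> int d" if "P \<in> X" for P
    using X that by (simp add: polyhedral_complex_def complex_dim_def flip: assms(2))
  have "int d \<in> aff_dim ` X"
    unfolding assms(2)[symmetric] complex_dim_def
    by (rule Max_in) (use X in \<open>auto simp: polyhedral_complex_def\<close>)
  then have "\<Union>X \<noteq> {}" by force
  moreover have "subcomplex_Inter X C {} = X" by (simp add: subcomplex_Inter_def)
  ultimately have "acyclic_over TYPE('k) X" using acyc[of "{}"] by (metis empty_subsetI)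
  with X interpret acyclic_polyhedral_complex X "TYPE('k)" by unfold_locales
  have covers_nothing: "\<Union>(subcomplex_Inter X C F) = {} \<longleftrightarrow>
      (I_Delta X B C :: ('b, 'k) mpoly set) \<subseteq> var_ideal B F" if "F \<subseteq> B" for F
    using no_common_vertex_iff[OF X, of F C] C that
    by (auto simp: I_Delta_subset_var_ideal_iff[OF assms(4) that])
  have empty: "\<Union>(subcomplex_Inter X C (Bp p)) = {}" if "p \<in> {1..d+1}" for p
    using covers_nothing[OF Bp] assms(9) that by blast
  have "\<exists>i A. (\<forall>p\<in>{1..d+1}. i p \<in> Bp p) \<and> A \<subseteq> i ` {1..d+1} \<and> A \<noteq> {} \<and>
      \<not> exact_on (\<Inter>i\<in>A. C i)"
  proof (rule colourful_cover)
    show "exact_on X" using exact_on_if_acyclic acyclic by blast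
    show "cell_rank P \<in> {1..d+1}" if "P \<in> X" "P \<noteq> {}" for P
    proof -
      have "0 \<le> aff_dim P" using that(2) aff_dim_negative_iff[of P] by linarith
      with dim_le[OF that(1)] show ?thesis by (auto simp: cell_rank_def)
    qed
    show "closed_cells (C i) \<and> {} \<in> C i" if "p \<in> {1..d+1}" "i \<in> Bp p" for p i
    proof -
      have "induced_subcomplex X (C i)" using C Bp[OF that(1)] that(2) by blast
      note sub = induced_subcomplexD[OF X this]
      have "closed_cells (C i)" by (rule closed_cellsI[OF sub(1)]) (rule sub(3))
      with sub(2) show ?thesis by simp
    qed
    show "\<exists>i\<in>Bp p. P \<notin> C i" if "p \<in> {1..d+1}" "P \<in> X" "P \<noteq> {}" for p P
      using empty[OF that(1)] that by (auto simp: subcomplex_Inter_def)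
    show "Bp p \<noteq> {}" if "p \<in> {1..d+1}" for p
      using empty[OF that] \<open>\<Union>X \<noteq> {}\<close> \<open>subcomplex_Inter X C {} = X\<close> by auto
  qed
  then obtain i A where i: "\<forall>p\<in>{1..d+1}. i p \<in> Bp p"
    and A: "A \<subseteq> i ` {1..d+1}" "A \<noteq> {}" "\<not> exact_on (\<Inter>i\<in>A. C i)" by blast
  have iB: "i ` {1..d+1} \<subseteq> B" using i Bp by blast
  with A have AB: "A \<subseteq> B" by blast
  have "(\<Inter>i\<in>A. C i) = subcomplex_Inter X C A"
    using A(2) AB induced_subcomplexD(1)[OF X C] unfolding subcomplex_Inter_def by blast
  then have "\<not> exact_on (subcomplex_Inter X C A)" using A(3) by simp
  moreover have "subcomplex_Inter X C A \<subseteq> X" by (auto simp: subcomplex_Inter_def)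
  ultimately have "\<Union>(subcomplex_Inter X C A) = {}"
    using acyc[OF AB] exact_on_if_acyclic[of "subcomplex_Inter X C A"] by blast
  moreover have "subcomplex_Inter X C (i ` {1..d+1}) \<subseteq> subcomplex_Inter X C A"
    using A(1) unfolding subcomplex_Inter_def by blast
  ultimately have "\<Union>(subcomplex_Inter X C (i ` {1..d+1})) = {}" by blast
  with i show ?thesis using covers_nothing[OF iB] by blast
qed

end
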